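(* Let $\mathcal{A}$ be the $9$-dimensional affine space of real $4\times4$ matrices all of whose row sums and column sums equal $1$, with direction space $W=\{X\in\mathbb{R}^{4\times4}: \text{all row and column sums of } X \text{ are } 0\}$ and inner product $\langle X,Y\rangle=\mathrm{Tr}(XY^T)$. Let $B_\star\in\mathcal{A}$ be the matrix with all entries $1/4$. Index rows and columns by $0,1,2,3$, and for $r,c\in\{1,2,3\}$ let $\Pi_{r,c}=\{B\in\mathcal{A}: B_{00}+B_{0c}+B_{r0}+B_{rc}=1\}$, a hyperplane in $\mathcal{A}$ through $B_\star$, with normal vector $n_{r,c}\in W$ (orthogonal in $W$ to the direction space of $\Pi_{r,c}$). For a permutation $\sigma$ of $\{0,1,2,3\}$ let $P_\sigma$ be the permutation matrix with $(P_\sigma)_{i,\sigma(i)}=1$. Let $V=\{e,(01)(23),(02)(13),(03)(12)\}$ be the Klein four-subgroup of $S_4$, and for each of its six cosets $\tau V$ let $T_{\tau V}$ be the convex hull of $\{P_\sigma:\sigma\in\tau V\}$ (a regular tetrahedron centered at $B_\star$). Then: (i) the nine hyperplanes $\Pi_{r,c}$ are pairwise orthogonal (the normals $n_{r,c}$ are pairwise orthogonal), and each of the $24$ permutation matrices lies on at least one of them; (ii) each tetrahedron $T_{\tau V}$ is contained in exactly six of the nine hyperplanes, and the direction space of its affine span contains the normal vectors of the remaining three hyperplanes; (iii) each hyperplane $\Pi_{r,c}$ contains exactly four of the six tetrahedra, and the line $B_\star+\mathbb{R}\,n_{r,c}$ is the intersection of the affine spans of the remaining two tetrahedra.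
   Context: The set of $4\times4$ bistochastic matrices (nonnegative entries, all row and column sums $1$) is a convex polytope in $\mathcal{A}$ whose vertices are the $24$ permutation matrices. *)

theory Defs
  imports "HOL-Analysis.Analysis"
begin

text \<open>Rows and columns are indexed by the four-element type \<open>4\<close>, whose elements are
  \<open>0, 1, 2, 3\<close>. The inner product of the library on \<open>real^4^4\<close> is the trace form.\<close>

lemma inner_eq_trace:
  fixes X Y :: "real^4^4"
  shows "X \<bullet> Y = trace (X ** Finite_Cartesian_Product.transpose Y)"
  by (simp add: trace_def matrix_matrix_mult_def Finite_Cartesian_Product.transpose_def
      inner_vec_def)

definition unit_sums :: "(real^4^4) set" where
  "unit_sums = {X. (\<forall>i. (\<Sum>j\<in>UNIV. X $ i $ j) = 1) \<and> (\<forall>j. (\<Sum>i\<in>UNIV. X $ i $ j) = 1)}"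

definition zero_sums :: "(real^4^4) set" where
  "zero_sums = {X. (\<forall>i. (\<Sum>j\<in>UNIV. X $ i $ j) = 0) \<and> (\<forall>j. (\<Sum>i\<in>UNIV. X $ i $ j) = 0)}"

definition direction_space :: "'a::real_vector set \<Rightarrow> 'a set" where
  "direction_space S = {x - y | x y. x \<in> S \<and> y \<in> S}"

definition B_star :: "real^4^4" where
  "B_star = (\<chi> i j. 1/4)"

definition Pi_hyp :: "4 \<Rightarrow> 4 \<Rightarrow> (real^4^4) set" where
  "Pi_hyp r c = {B \<in> unit_sums. B $ 0 $ 0 + B $ 0 $ c + B $ r $ 0 + B $ r $ c = 1}"

text \<open>A normal vector is only determined up to a nonzero factor.\<close>

definition is_normal :: "(real^4^4) set \<Rightarrow> real^4^4 \<Rightarrow> bool" where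
  "is_normal H n \<longleftrightarrow> n \<in> zero_sums \<and> n \<noteq> 0 \<and> (\<forall>d \<in> direction_space H. orthogonal n d)"

definition perm_matrix :: "(4 \<Rightarrow> 4) \<Rightarrow> real^4^4" where
  "perm_matrix \<sigma> = (\<chi> i j. if j = \<sigma> i then 1 else 0)"

definition klein_V :: "(4 \<Rightarrow> 4) set" where
  "klein_V = {id,
     Transposition.transpose 0 1 \<circ> Transposition.transpose 2 3,
     Transposition.transpose 0 2 \<circ> Transposition.transpose 1 3,
     Transposition.transpose 0 3 \<circ> Transposition.transpose 1 2}"

definition klein_cosets :: "(4 \<Rightarrow> 4) set set" where
  "klein_cosets = {(\<lambda>v. \<tau> \<circ> v) ` klein_V | \<tau>. \<tau> permutes UNIV}"

definition coset_tetrahedron :: "(4 \<Rightarrow> 4) set \<Rightarrow> (real^4^4) set" where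
  "coset_tetrahedron C = convex hull (perm_matrix ` C)"

definition regular_tetrahedron :: "'a::euclidean_space set \<Rightarrow> 'a \<Rightarrow> bool" where
  "regular_tetrahedron T b \<longleftrightarrow>
    (\<exists>K. \<not> affine_dependent K \<and> card K = 4 \<and> T = convex hull K \<and>
      (\<exists>d. \<forall>x\<in>K. \<forall>y\<in>K. x \<noteq> y \<longrightarrow> dist x y = d) \<and> b = (1/4) *\<^sub>R (\<Sum>x\<in>K. x))"

lemma sum_UNIV_4:
  fixes f :: "4 \<Rightarrow> 'a::comm_monoid_add"
  shows "sum f UNIV = f 0 + f 1 + f 2 + f 3"
proof -
  have "(4::4) = 0" by simp
  then show ?thesis by (simp only: sum_4 ac_simps)
qed

lemma normal_exists:
  assumes r: "r \<in> {1,2,3}" and c: "c \<in> {1,2,3}"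
  shows "\<exists>n. is_normal (Pi_hyp r c) n"
proof -
  define n :: "real^4^4" where
    "n = (\<chi> i j. (if i = 0 \<or> i = r then 1 else -1) * (if j = 0 \<or> j = c then 1 else -1))"
  have "n $ 0 $ 0 = 1" by (simp add: n_def)
  then have "n \<noteq> 0" by auto
  moreover have "n \<in> zero_sums"
  proof -
    have 1: "(\<Sum>j\<in>UNIV. if j = 0 \<or> j = k then 1 else - 1 :: real) = 0" if "k \<in> {1,2,3}" for k :: 4
      using that by (auto simp: sum_UNIV_4)
    have "(\<Sum>j\<in>UNIV. n $ i $ j) = 0" for i
      unfolding n_def vec_lambda_beta sum_distrib_left[symmetric] 1[OF c]
      by (simp only: mult_zero_right)
    moreover have "(\<Sum>i\<in>UNIV. n $ i $ j) = 0" for j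
      unfolding n_def vec_lambda_beta sum_distrib_right[symmetric] 1[OF r]
      by (simp only: mult_zero_left)
    ultimately show ?thesis
      by (simp add: zero_sums_def)
  qed
  moreover have "orthogonal n (x - y)" if x: "x \<in> Pi_hyp r c" and y: "y \<in> Pi_hyp r c" for x y
  proof -
    have "n \<bullet> z = 4 * (z $ 0 $ 0 + z $ 0 $ c + z $ r $ 0 + z $ r $ c) - 4" if "z \<in> unit_sums" for z
    proof -
      have row: "z $ i $ 0 + z $ i $ 1 + z $ i $ 2 + z $ i $ 3 = 1" for i
        using that by (simp add: unit_sums_def flip: sum_UNIV_4)
      have col: "z $ 0 $ j + z $ 1 $ j + z $ 2 $ j + z $ 3 $ j = 1" for j
        using that by (simp add: unit_sums_def sum_UNIV_4)
      show ?thesis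
        using r c row[of 0] row[of 1] row[of 2] row[of 3] col[of 0] col[of 1] col[of 2] col[of 3]
        by (elim insertE emptyE; simp add: n_def inner_vec_def sum_UNIV_4)
    qed
    then show ?thesis
      using x y by (simp add: orthogonal_def inner_diff_right Pi_hyp_def)
  qed
  ultimately show ?thesis
    unfolding is_normal_def direction_space_def by blast
qed

end

theory Submission
  imports Defs
begin

text \<open>Diagonalise by the Hadamard basis: the sixteen matrices \<open>\<chi>\<^sub>a \<chi>\<^sub>b\<^sup>T\<close>, where
  \<open>\<chi>\<^sub>0, \<dots>, \<chi>\<^sub>3\<close> are the characters of the Klein group with its elements labelled by
  \<open>0, \<dots>, 3\<close>, are pairwise orthogonal. For \<open>r, c \<noteq> 0\<close> the matrix \<open>\<chi>\<^sub>r \<chi>\<^sub>c\<^sup>T\<close> is a normal of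
  \<open>Pi_hyp r c\<close>. Every coset of the Klein group contains exactly one \<open>\<pi>\<close> fixing \<open>0\<close>; such a
  \<open>\<pi>\<close> permutes the characters, so the permutation matrices of its coset only involve the
  coordinates \<open>(a, \<pi> a)\<close>. Thus every set in the theorem, or its affine hull, is \<open>B_star\<close> plus
  the span of the basis matrices with indices in some \<open>S \<subseteq> {1,2,3} \<times> {1,2,3}\<close>: the complement
  of \<open>(r, c)\<close> for a hyperplane, the graph of \<open>\<pi>\<close> for a tetrahedron. The claims become
  statements about such index sets.\<close>

section \<open>Characters and translations of the Klein four-group\<close>

lemma cases_4:
  fixes i :: 4
  obtains "i = 0" | "i = 1" | "i = 2" | "i = 3"
proof -
  have "(4::4) = 0" by simp
  then show ?thesis
    using exhaust_4[of i] that by metis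
qed

lemma all_4: "(\<forall>i::4. P i) \<longleftrightarrow> P 0 \<and> P 1 \<and> P 2 \<and> P 3"
  by (metis cases_4)

lemma nonzero_4: "i \<noteq> 0 \<longleftrightarrow> i \<in> {1, 2, 3}" for i :: 4
  by (cases i rule: cases_4) auto

text \<open>A nontrivial character of the Klein group has a two-element kernel; the label
  \<open>a\<close> is chosen so that this kernel is {0, a}. The character table is then symmetric in
  its two arguments.\<close>

definition had :: "4 \<Rightarrow> 4 \<Rightarrow> real" where
  "had a i = (if a = 0 \<or> i = 0 \<or> i = a then 1 else -1)"

text \<open>\<open>klein k\<close> is the element of the Klein group sending \<open>0\<close> to \<open>k\<close>. As \<open>2 = 1 + 2 + 3\<close> in
  the type \<open>4\<close>, the value \<open>2 - i - k\<close> is the third nonzero index.\<close>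

definition klein :: "4 \<Rightarrow> 4 \<Rightarrow> 4" where
  "klein k i = (if k = 0 then i else if i = 0 then k else if i = k then 0 else 2 - i - k)"

lemma had_commute: "had a i = had i a"
  by (auto simp: had_def)

lemma had_0 [simp]: "had 0 i = 1" "had a 0 = 1"
  by (auto simp: had_def)

lemma had_orthogonal: "(\<Sum>i\<in>UNIV. had a i * had b i) = (if a = b then 4 else 0)"
  by (cases a rule: cases_4; cases b rule: cases_4) (simp_all add: sum_UNIV_4 had_def)

text \<open>The table is symmetric with orthogonal rows of squared norm 4, so its square is 4 times
  the identity: Fourier inversion, with the same table in both directions.\<close>

lemma had_inversion: "(\<Sum>a\<in>UNIV. had a k * (\<Sum>i\<in>UNIV. had a i * f i)) = 4 * f k"
  by (cases k rule: cases_4) (simp_all add: sum_UNIV_4 had_def)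

lemma klein_0 [simp]: "klein k 0 = k" "klein 0 k = k"
  by (auto simp: klein_def)

lemma had_klein: "had a (klein k i) = had a k * had a i"
  by (cases a rule: cases_4; cases k rule: cases_4; cases i rule: cases_4)
    (simp_all add: had_def klein_def)

lemma klein_commute: "klein k i = klein i k"
  by (cases k rule: cases_4; cases i rule: cases_4) (simp_all add: klein_def)

lemma klein_assoc: "klein k (klein l i) = klein (klein k l) i"
  by (cases k rule: cases_4; cases l rule: cases_4; cases i rule: cases_4)
    (simp_all add: klein_def)

lemma klein_self [simp]: "klein k k = 0"
  by (simp add: klein_def)

lemma UNIV_4': "(UNIV :: 4 set) = {0, 1, 2, 3}"
  by (auto intro: cases_4)

lemma klein_V_eq: "klein_V = range klein"
proof -
  have
    "klein 0 = id"
    "klein 1 = Transposition.transpose 0 1 \<circ> Transposition.transpose 2 3"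
    "klein 2 = Transposition.transpose 0 2 \<circ> Transposition.transpose 1 3"
    "klein 3 = Transposition.transpose 0 3 \<circ> Transposition.transpose 1 2"
    by (simp_all add: fun_eq_iff all_4 klein_def Transposition.transpose_def)
  then show ?thesis
    unfolding klein_V_def UNIV_4' by (simp only: image_insert image_empty)
qed

lemma klein_left_inverse [simp]: "klein k (klein k i) = i"
  by (simp add: klein_assoc)

lemma klein_eq_iff [simp]: "klein k i = klein k j \<longleftrightarrow> i = j"
  by (metis klein_left_inverse)

lemma klein_eq_iff' [simp]: "klein k i = klein l i \<longleftrightarrow> k = l"
  by (metis klein_commute klein_eq_iff)

lemma klein_permutes: "klein k permutes UNIV"
  by (rule bij_imp_permutes) (auto intro!: bij_betw_byWitness[where f' = "klein k"])

section \<open>The Hadamard matrix basis and its coordinate flats\<close>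

definition had_mat :: "4 \<Rightarrow> 4 \<Rightarrow> real^4^4" where
  "had_mat a b = (\<chi> i j. had a i * had b j)"

lemma inner_had_mat: "had_mat a b \<bullet> x = (\<Sum>i\<in>UNIV. had a i * (\<Sum>j\<in>UNIV. had b j * x $ i $ j))"
  by (simp add: inner_vec_def had_mat_def sum_distrib_left mult.assoc)

lemma had_mat_orthogonal: "had_mat a b \<bullet> had_mat c d = (if a = c \<and> b = d then 16 else 0)"
proof -
  have "had_mat a b \<bullet> had_mat c d
      = (\<Sum>i\<in>UNIV. had a i * had c i) * (\<Sum>j\<in>UNIV. had b j * had d j)"
    unfolding inner_had_mat sum_product by (simp add: had_mat_def sum_distrib_left mult_ac)
  then show ?thesis
    by (simp add: had_orthogonal)
qed

text \<open>One-dimensional inversion applied twice, first along the columns and then along the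
  rows, each time with a factor 4. Hence the sixteen coordinates determine a matrix.\<close>

lemma had_mat_expansion:
  "(\<Sum>a\<in>UNIV. had a k * (\<Sum>b\<in>UNIV. had b l * (had_mat a b \<bullet> x))) = 16 * x $ k $ l"
proof -
  have "(\<Sum>b\<in>UNIV. had b l * (had_mat a b \<bullet> x))
      = (\<Sum>i\<in>UNIV. had a i * (\<Sum>b\<in>UNIV. had b l * (\<Sum>j\<in>UNIV. had b j * x $ i $ j)))" for a
    unfolding inner_had_mat sum_distrib_left
    by (subst sum.swap) (simp add: mult_ac)
  also have "\<dots> a = (\<Sum>i\<in>UNIV. had a i * (4 * x $ i $ l))" for a
    by (simp only: had_inversion)
  finally show ?thesis
    by (simp add: had_inversion)
qed

lemma had_mat_eqI:
  assumes "\<And>a b. had_mat a b \<bullet> x = had_mat a b \<bullet> y"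
  shows "x = y"
proof -
  have "16 * x $ k $ l = 16 * y $ k $ l" for k l
    unfolding had_mat_expansion[symmetric] assms ..
  then show ?thesis
    by (simp add: vec_eq_iff)
qed

text \<open>Vanishing coordinates, rather than a span, make intersections and inclusions immediate
  from the index sets; \<open>had_space_eq_span\<close> gives the other view.\<close>

definition had_space :: "(4 \<times> 4) set \<Rightarrow> (real^4^4) set" where
  "had_space S = {x. \<forall>a b. (a, b) \<notin> S \<longrightarrow> had_mat a b \<bullet> x = 0}"

definition had_flat :: "(4 \<times> 4) set \<Rightarrow> (real^4^4) set" where
  "had_flat S = (+) B_star ` had_space S"

lemma mem_had_flat: "x \<in> had_flat S \<longleftrightarrow> x - B_star \<in> had_space S"
  unfolding had_flat_def by (auto simp: image_iff intro!: bexI[of _ "x - B_star"])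

lemma had_mat_in_had_space [simp]: "had_mat a b \<in> had_space S \<longleftrightarrow> (a, b) \<in> S"
  by (auto simp: had_space_def had_mat_orthogonal)

lemma subspace_had_space: "subspace (had_space S)"
  by (auto simp: subspace_def had_space_def inner_add_right)

lemma had_space_remove:
  assumes "(a, b) \<in> S"
  shows "had_space (S - {(a, b)}) = {x \<in> had_space S. had_mat a b \<bullet> x = 0}"
  using assms unfolding had_space_def by blast

lemma had_space_eq_span: "had_space S = span (case_prod had_mat ` S)"
proof
  show "span (case_prod had_mat ` S) \<subseteq> had_space S"
    by (intro span_minimal subspace_had_space) auto
  show "had_space S \<subseteq> span (case_prod had_mat ` S)"
  proof
    fix x assume x: "x \<in> had_space S"
    \<comment> \<open>The orthogonal projection of \<open>x\<close> to the span; 16 is the squared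
      norm of every basis matrix.\<close>
    define y where "y = (\<Sum>p\<in>S. ((case_prod had_mat p \<bullet> x) / 16) *\<^sub>R case_prod had_mat p)"
    have "had_mat a b \<bullet> y = had_mat a b \<bullet> x" for a b
    proof -
      have "had_mat a b \<bullet> y = (\<Sum>p\<in>S. if p = (a, b) then had_mat a b \<bullet> x else 0)"
        unfolding y_def inner_sum_right
        by (intro sum.cong) (auto simp: had_mat_orthogonal split: if_splits)
      also have "\<dots> = had_mat a b \<bullet> x"
        using x by (simp add: had_space_def)
      finally show ?thesis .
    qed
    then have "y = x"
      by (rule had_mat_eqI)
    moreover have "y \<in> span (case_prod had_mat ` S)"
      unfolding y_def by (intro span_sum span_mul span_base) auto
    ultimately show "x \<in> span (case_prod had_mat ` S)"
      by simp
  qed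
qed

lemma dim_had_space: "dim (had_space S) = card S"
proof -
  have "inj_on (case_prod had_mat) S"
  proof (rule inj_onI, clarify)
    fix a b c d assume "had_mat a b = had_mat c d"
    then have "had_mat a b \<bullet> had_mat c d = had_mat a b \<bullet> had_mat a b"
      by simp
    then show "a = c \<and> b = d"
      by (auto simp: had_mat_orthogonal split: if_splits)
  qed
  moreover have "had_mat a b \<noteq> 0" for a b
    using had_mat_orthogonal[of a b a b] by auto
  then have "independent (case_prod had_mat ` S)"
    by (intro pairwise_orthogonal_independent)
      (auto simp: pairwise_def orthogonal_def had_mat_orthogonal)
  ultimately show ?thesis
    by (simp add: had_space_eq_span dim_eq_card_independent card_image)
qed

lemma affine_had_flat: "affine (had_flat S)"
  unfolding had_flat_def using subspace_imp_affine[OF subspace_had_space] affine_translation by blast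

lemma aff_dim_had_flat: "aff_dim (had_flat S) = int (card S)"
  unfolding had_flat_def
  by (simp add: aff_dim_translation_eq aff_dim_subspace subspace_had_space dim_had_space)

lemma B_star_in_had_flat: "B_star \<in> had_flat S"
  by (simp add: mem_had_flat subspace_0[OF subspace_had_space])

lemma direction_space_had_flat: "direction_space (had_flat S) = had_space S"
proof
  show "direction_space (had_flat S) \<subseteq> had_space S"
    unfolding direction_space_def had_flat_def
    by (auto intro: subspace_diff[OF subspace_had_space])
  show "had_space S \<subseteq> direction_space (had_flat S)"
  proof
    fix x assume "x \<in> had_space S"
    then have "B_star + x \<in> had_flat S"
      by (simp add: had_flat_def)
    then show "x \<in> direction_space (had_flat S)"
      unfolding direction_space_def using B_star_in_had_flat by force
  qed
qed

text \<open>The point \<open>B_star + had_mat a b\<close> tests whether \<open>(a, b)\<close> is an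
  index of a flat, so a flat determines its index set.\<close>

lemma had_flat_subset_iff: "had_flat S \<subseteq> had_flat T \<longleftrightarrow> S \<subseteq> T"
proof
  assume sub: "had_flat S \<subseteq> had_flat T"
  show "S \<subseteq> T"
  proof clarify
    fix a b assume "(a, b) \<in> S"
    then have "B_star + had_mat a b \<in> had_flat S"
      by (simp add: mem_had_flat)
    then have "B_star + had_mat a b \<in> had_flat T"
      using sub by blast
    then show "(a, b) \<in> T"
      by (simp add: mem_had_flat)
  qed
next
  assume "S \<subseteq> T"
  then show "had_flat S \<subseteq> had_flat T"
    unfolding had_flat_def had_space_def by blast
qed

lemma had_flat_eq_iff: "had_flat S = had_flat T \<longleftrightarrow> S = T"
  using had_flat_subset_iff by blast

lemma had_flat_Int: "had_flat S \<inter> had_flat T = had_flat (S \<inter> T)"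
  by (auto simp: mem_had_flat had_space_def)

section \<open>The affine space and the hyperplanes in Hadamard coordinates\<close>

lemma inner_had_mat_B_star: "had_mat a b \<bullet> B_star = (if a = 0 \<and> b = 0 then 4 else 0)"
proof -
  have "B_star = (1/4) *\<^sub>R had_mat 0 0"
    by (simp add: vec_eq_iff B_star_def had_mat_def)
  then show ?thesis
    unfolding \<open>B_star = _\<close> by (simp add: had_mat_orthogonal)
qed

text \<open>By inversion, the vector of row sums vanishes iff its transform does, and likewise for
  column sums. These two transforms are exactly the coordinates \<open>(a, 0)\<close> and
  \<open>(0, b)\<close>.\<close>

lemma zero_sums_eq: "zero_sums = had_space ({1,2,3} \<times> {1,2,3})"
proof -
  have iff: "(\<forall>i. f i = 0) \<longleftrightarrow> (\<forall>a. (\<Sum>i\<in>UNIV. had a i * f i) = 0)" for f :: "4 \<Rightarrow> real"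
  proof (intro iffI allI)
    fix k assume "\<forall>a. (\<Sum>i\<in>UNIV. had a i * f i) = 0"
    then show "f k = 0"
      using had_inversion[of k f] by simp
  qed simp
  have 1: "had_mat a 0 \<bullet> x = (\<Sum>i\<in>UNIV. had a i * (\<Sum>j\<in>UNIV. x $ i $ j))" for a x
    by (simp add: inner_had_mat)
  have 2: "had_mat 0 b \<bullet> x = (\<Sum>j\<in>UNIV. had b j * (\<Sum>i\<in>UNIV. x $ i $ j))" for b x
    unfolding inner_had_mat sum_distrib_left by (subst sum.swap) simp
  have "x \<in> zero_sums \<longleftrightarrow> (\<forall>a. had_mat a 0 \<bullet> x = 0) \<and> (\<forall>b. had_mat 0 b \<bullet> x = 0)" for x
    unfolding zero_sums_def mem_Collect_eq 1 2
    using iff[of "\<lambda>i. \<Sum>j\<in>UNIV. x $ i $ j"] iff[of "\<lambda>j. \<Sum>i\<in>UNIV. x $ i $ j"] by argo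
  then show ?thesis
    unfolding had_space_def mem_Times_iff fst_conv snd_conv nonzero_4[symmetric] set_eq_iff mem_Collect_eq
    by metis
qed

lemma unit_sums_eq: "unit_sums = had_flat ({1,2,3} \<times> {1,2,3})"
proof -
  have "x \<in> unit_sums \<longleftrightarrow> x - B_star \<in> zero_sums" for x
    by (simp add: unit_sums_def zero_sums_def B_star_def sum_subtractf)
  then show ?thesis
    unfolding set_eq_iff mem_had_flat zero_sums_eq by blast
qed

text \<open>\<open>had r\<close> is twice the indicator of {0, r} minus 1. In the product with
  \<open>had c\<close>, every term containing a constant factor pairs with \<open>z\<close> to a
  combination of row or column sums, so only 4 times the block indicator survives.\<close>

lemma inner_had_mat_zero_sums:
  assumes z: "z \<in> zero_sums" and r: "r \<in> {1,2,3}" and c: "c \<in> {1,2,3}"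
  shows "had_mat r c \<bullet> z = 4 * (z $ 0 $ 0 + z $ 0 $ c + z $ r $ 0 + z $ r $ c)"
proof -
  have row: "z $ i $ 0 + z $ i $ 1 + z $ i $ 2 + z $ i $ 3 = 0" for i
    using z by (simp add: zero_sums_def flip: sum_UNIV_4)
  have col: "z $ 0 $ j + z $ 1 $ j + z $ 2 $ j + z $ 3 $ j = 0" for j
    using z by (simp add: zero_sums_def sum_UNIV_4)
  show ?thesis
    using r c row[of 0] row[of 1] row[of 2] row[of 3] col[of 0] col[of 1] col[of 2] col[of 3]
    by (elim insertE emptyE; simp add: inner_had_mat had_def sum_UNIV_4)
qed

text \<open>The block of \<open>B_star\<close> itself sums to 1, so the defining equation says that
  the deviation from \<open>B_star\<close> has vanishing coordinate \<open>(r, c)\<close>.\<close>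

lemma Pi_hyp_eq:
  assumes r: "r \<in> {1,2,3}" and c: "c \<in> {1,2,3}"
  shows "Pi_hyp r c = had_flat ({1,2,3} \<times> {1,2,3} - {(r, c)})"
proof -
  have rc: "(r, c) \<in> {1,2,3} \<times> {1,2,3}"
    using r c by (rule SigmaI)
  have "x \<in> Pi_hyp r c \<longleftrightarrow> x \<in> unit_sums \<and> had_mat r c \<bullet> (x - B_star) = 0" for x
  proof (cases "x \<in> unit_sums")
    case True
    then have "x - B_star \<in> zero_sums"
      by (simp add: unit_sums_eq zero_sums_eq mem_had_flat)
    from inner_had_mat_zero_sums[OF this r c]
    have "had_mat r c \<bullet> (x - B_star) = 4 * (x $ 0 $ 0 + x $ 0 $ c + x $ r $ 0 + x $ r $ c - 1)"
      by (simp add: B_star_def)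
    with True show ?thesis
      unfolding Pi_hyp_def by auto
  qed (simp add: Pi_hyp_def)
  then show ?thesis
    unfolding set_eq_iff unit_sums_eq mem_had_flat had_space_remove[OF rc] by blast
qed

text \<open>All other coordinates of \<open>n\<close> vanish: for nonzero indices because
  \<open>had_mat a b\<close> is a direction of the hyperplane, and for the rest because
  \<open>n\<close> has zero sums.\<close>

lemma is_normal_Pi_hyp:
  assumes r: "r \<in> {1,2,3}" and c: "c \<in> {1,2,3}" and n: "is_normal (Pi_hyp r c) n"
  obtains s where "s \<noteq> 0" "n = s *\<^sub>R had_mat r c"
proof -
  have "had_mat a b \<bullet> n = 0" if "(a, b) \<noteq> (r, c)" for a b
  proof (cases "(a, b) \<in> {1,2,3} \<times> {1,2,3}")
    case True
    with that have "had_mat a b \<in> direction_space (Pi_hyp r c)"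
      by (simp add: Pi_hyp_eq[OF r c] direction_space_had_flat)
    with n show ?thesis
      by (auto simp: is_normal_def orthogonal_def inner_commute)
  next
    case False
    with n show ?thesis
      unfolding is_normal_def zero_sums_eq had_space_def by blast
  qed
  then have "n \<in> had_space {(r, c)}"
    by (simp add: had_space_def)
  then obtain s where "n = s *\<^sub>R had_mat r c"
    by (auto simp: had_space_eq_span span_singleton)
  moreover from this n have "s \<noteq> 0"
    by (auto simp: is_normal_def)
  ultimately show ?thesis
    using that by blast
qed

section \<open>Permutations fixing 0 and the cosets of the Klein group\<close>

lemma permutes_123_iff: "\<pi> permutes {1,2,3} \<longleftrightarrow> \<pi> permutes UNIV \<and> \<pi> 0 = 0" for \<pi> :: "4 \<Rightarrow> 4"
proof -
  have "x \<notin> {1,2,3} \<longleftrightarrow> x = 0" for x :: 4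
    using nonzero_4[of x] by blast
  then show ?thesis
    unfolding permutes_def by auto
qed

text \<open>The table depends only on equality of labels and on which label is 0. Algebraically,
  every permutation of the nonzero elements is an automorphism of the Klein group.\<close>

lemma had_permutes:
  assumes "\<pi> permutes {1,2,3}"
  shows "had (\<pi> a) (\<pi> i) = had a i"
proof -
  have "inj \<pi>" "\<pi> 0 = 0"
    using assms permutes_inj permutes_123_iff by blast+
  then show ?thesis
    unfolding had_def by (metis injD)
qed

definition klein_coset :: "(4 \<Rightarrow> 4) \<Rightarrow> (4 \<Rightarrow> 4) set" where
  "klein_coset \<pi> = range (\<lambda>k. \<pi> \<circ> klein k)"

text \<open>For \<pi> fixing 0 the graph point (0, 0) is left out, since that coordinate belongs to
  the base point \<open>B_star\<close>.\<close>

definition graph_123 :: "(4 \<Rightarrow> 4) \<Rightarrow> (4 \<times> 4) set" where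
  "graph_123 \<pi> = (\<lambda>a. (a, \<pi> a)) ` {1,2,3}"

lemma card_graph_123: "card (graph_123 \<pi>) = 3"
  unfolding graph_123_def by (subst card_image) (auto simp: inj_on_def)

text \<open>Translating by the preimage \<open>k\<close> of 0 yields a permutation fixing 0, and
  \<open>klein k\<close> undoes itself.\<close>

lemma permutes_UNIV_klein:
  fixes \<tau> :: "4 \<Rightarrow> 4"
  assumes \<tau>: "\<tau> permutes UNIV"
  obtains \<pi> k where "\<pi> permutes {1,2,3}" "\<tau> = \<pi> \<circ> klein k"
proof -
  define k where "k = inv \<tau> 0"
  have "\<tau> k = 0"
    by (simp add: k_def permutes_inverses[OF \<tau>])
  then have "\<tau> \<circ> klein k permutes {1,2,3}"
    using permutes_compose[OF klein_permutes \<tau>] by (simp add: permutes_123_iff)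
  moreover have "\<tau> = (\<tau> \<circ> klein k) \<circ> klein k"
    by (simp add: fun_eq_iff)
  ultimately show ?thesis
    using that by blast
qed

lemma klein_cosets_eq: "klein_cosets = klein_coset ` {\<pi>. \<pi> permutes {1,2,3}}"
proof -
  have coset: "(\<lambda>v. \<tau> \<circ> v) ` klein_V = klein_coset \<tau>" for \<tau>
    by (simp add: klein_V_eq klein_coset_def image_image)
  \<comment> \<open>Precomposition with a translation merely reorders the translates, so the coset
    is independent of its representative.\<close>
  have "klein_coset (\<pi> \<circ> klein k) = klein_coset \<pi>" for \<pi> k
  proof -
    have "surj (klein k)"
      by (rule permutes_surj[OF klein_permutes])
    moreover have "klein_coset (\<pi> \<circ> klein k) = (\<lambda>l. \<pi> \<circ> klein l) ` range (klein k)"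
      by (simp add: klein_coset_def image_image comp_def klein_assoc)
    ultimately show ?thesis
      by (simp add: klein_coset_def)
  qed
  then have "\<exists>\<pi>. \<pi> permutes {1,2,3} \<and> klein_coset \<tau> = klein_coset \<pi>" if "\<tau> permutes UNIV" for \<tau>
    using permutes_UNIV_klein[OF that] by metis
  then show ?thesis
    unfolding klein_cosets_def coset by (auto simp: permutes_123_iff)
qed

section \<open>Permutation matrices and the coset tetrahedra\<close>

lemma inj_perm_matrix: "inj perm_matrix"
proof (rule injI, rule ext)
  fix \<sigma> \<tau> i assume "perm_matrix \<sigma> = perm_matrix \<tau>"
  then have "perm_matrix \<sigma> $ i $ \<sigma> i = perm_matrix \<tau> $ i $ \<sigma> i"
    by simp
  then show "\<sigma> i = \<tau> i"
    by (simp add: perm_matrix_def split: if_splits)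
qed

lemma inj_perm_matrix_klein:
  assumes \<pi>: "\<pi> permutes {1,2,3}"
  shows "inj (\<lambda>k. perm_matrix (\<pi> \<circ> klein k))"
proof (rule injI)
  fix k l assume "perm_matrix (\<pi> \<circ> klein k) = perm_matrix (\<pi> \<circ> klein l)"
  then have "(\<pi> \<circ> klein k) 0 = (\<pi> \<circ> klein l) 0"
    by (metis inj_perm_matrix injD)
  then show "k = l"
    by (simp add: inj_eq[OF permutes_inj[OF \<pi>]])
qed

lemma inner_had_mat_perm_matrix:
  "had_mat a b \<bullet> perm_matrix \<sigma> = (\<Sum>i\<in>UNIV. had a i * had b (\<sigma> i))"
  by (simp add: inner_had_mat perm_matrix_def if_distrib cong: if_cong)

text \<open>With \<open>b = \<pi> c\<close>, invariance removes \<pi> and multiplicativity pulls out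
  \<open>had c k\<close>; what remains is the orthogonality sum of \<open>a\<close> and
  \<open>c\<close>. Within a coset, only the sign of a coordinate depends on
  \<open>k\<close>.\<close>

lemma inner_had_mat_klein_coset:
  assumes \<pi>: "\<pi> permutes {1,2,3}"
  shows "had_mat a b \<bullet> perm_matrix (\<pi> \<circ> klein k) = (if b = \<pi> a then 4 * had a k else 0)"
proof -
  obtain c where b: "b = \<pi> c"
    using permutes_surj[OF \<pi>] by blast
  have "had_mat a b \<bullet> perm_matrix (\<pi> \<circ> klein k) = had c k * (\<Sum>i\<in>UNIV. had a i * had c i)"
    by (simp add: inner_had_mat_perm_matrix b had_permutes[OF \<pi>] had_klein sum_distrib_left mult_ac)
  also have "\<dots> = (if b = \<pi> a then 4 * had a k else 0)"
    using permutes_inj[OF \<pi>] by (auto simp: b had_orthogonal inj_eq)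
  finally show ?thesis .
qed

text \<open>Coordinate (0, 0) is 4 for the permutation matrix and for \<open>B_star\<close>, so it
  cancels in the difference.\<close>

lemma perm_matrix_in_had_flat:
  assumes \<pi>: "\<pi> permutes {1,2,3}"
  shows "perm_matrix (\<pi> \<circ> klein k) \<in> had_flat (graph_123 \<pi>)"
proof -
  have "\<pi> 0 = 0"
    using \<pi> permutes_123_iff by blast
  then have "had_mat a b \<bullet> (perm_matrix (\<pi> \<circ> klein k) - B_star) = 0" if "(a, b) \<notin> graph_123 \<pi>" for a b
    using that
    by (cases "a = 0")
      (auto simp: inner_diff_right inner_had_mat_klein_coset[OF \<pi>] inner_had_mat_B_star
        graph_123_def nonzero_4)
  then show ?thesis
    by (simp add: mem_had_flat had_space_def)
qed

lemma affine_hull_coset_tetrahedron: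
  assumes \<pi>: "\<pi> permutes {1,2,3}"
  shows "affine hull (coset_tetrahedron (klein_coset \<pi>)) = had_flat (graph_123 \<pi>)"
proof -
  define P where "P k = perm_matrix (\<pi> \<circ> klein k)" for k
  have range_P: "perm_matrix ` klein_coset \<pi> = range P"
    by (simp add: klein_coset_def P_def image_image)
  have "x \<in> affine hull range P" if x: "x \<in> had_flat (graph_123 \<pi>)" for x
  proof -
    have \<pi>0: "\<pi> 0 = 0"
      using \<pi> permutes_123_iff by blast
    have x0: "had_mat a b \<bullet> x = (if a = 0 \<and> b = 0 then 4 else 0)" if "(a, b) \<notin> graph_123 \<pi>" for a b
      using x that by (auto simp: mem_had_flat had_space_def inner_diff_right inner_had_mat_B_star)
    \<comment> \<open>The weights come from Fourier inversion: the combination has coordinate 4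
      times the transform of \<open>w\<close> at \<open>(a, \<pi> a)\<close>, and inverting costs
      another 4, hence 16.\<close>
    define w where "w k = (\<Sum>a\<in>UNIV. had a k * (had_mat a (\<pi> a) \<bullet> x)) / 16" for k
    have *: "(\<Sum>k\<in>UNIV. had a k * w k) = (had_mat a (\<pi> a) \<bullet> x) / 4" for a
    proof -
      have "16 * (\<Sum>k\<in>UNIV. had a k * w k)
          = (\<Sum>k\<in>UNIV. had k a * (\<Sum>a\<in>UNIV. had k a * (had_mat a (\<pi> a) \<bullet> x)))"
        by (simp add: w_def sum_distrib_left[of 16] had_commute)
      then show ?thesis
        by (simp add: had_inversion)
    qed
    \<comment> \<open>The total weight is the transform of \<open>w\<close> at the trivial
      character, where the coordinate of \<open>x\<close> is 4.\<close>
    have "(0, 0) \<notin> graph_123 \<pi>"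
      by (auto simp: graph_123_def)
    then have "sum w UNIV = 1"
      using *[of 0] by (simp add: \<pi>0 x0)
    moreover have "inj P"
      unfolding P_def by (rule inj_perm_matrix_klein[OF \<pi>])
    \<comment> \<open>\<open>affine_hull_finite\<close> indexes weights by points rather than by
      \<open>k\<close>, hence the composition with \<open>inv P\<close>.\<close>
    ultimately have "(\<Sum>k\<in>UNIV. w k *\<^sub>R P k) \<in> affine hull range P"
      by (simp add: affine_hull_finite) (intro exI[of _ "w \<circ> inv P"], simp add: sum.reindex)
    moreover have "(\<Sum>k\<in>UNIV. w k *\<^sub>R P k) = x"
    proof (rule had_mat_eqI)
      fix a b
      show "had_mat a b \<bullet> (\<Sum>k\<in>UNIV. w k *\<^sub>R P k) = had_mat a b \<bullet> x"
      proof (cases "b = \<pi> a")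
        case True
        then have "had_mat a b \<bullet> (\<Sum>k\<in>UNIV. w k *\<^sub>R P k) = 4 * (\<Sum>k\<in>UNIV. had a k * w k)"
          by (simp add: inner_sum_right P_def inner_had_mat_klein_coset[OF \<pi>] sum_distrib_left mult_ac)
        then show ?thesis
          by (simp add: * True)
      next
        case False
        then have "(a, b) \<notin> graph_123 \<pi>" "\<not> (a = 0 \<and> b = 0)"
          by (auto simp: graph_123_def \<pi>0)
        with False show ?thesis
          by (simp add: inner_sum_right P_def inner_had_mat_klein_coset[OF \<pi>] x0)
      qed
    qed
    ultimately show ?thesis
      by simp
  qed
  moreover have "affine hull range P \<subseteq> had_flat (graph_123 \<pi>)"
    by (intro hull_minimal affine_had_flat) (auto simp: P_def perm_matrix_in_had_flat[OF \<pi>])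
  ultimately show ?thesis
    unfolding coset_tetrahedron_def affine_hull_convex_hull range_P by blast
qed

lemma coset_tetrahedron_subset_had_flat:
  assumes "\<pi> permutes {1,2,3}"
  shows "coset_tetrahedron (klein_coset \<pi>) \<subseteq> had_flat S \<longleftrightarrow> graph_123 \<pi> \<subseteq> S"
proof -
  have "coset_tetrahedron (klein_coset \<pi>) \<subseteq> had_flat S
      \<longleftrightarrow> affine hull (coset_tetrahedron (klein_coset \<pi>)) \<subseteq> had_flat S"
    by (metis affine_had_flat hull_minimal hull_subset order_trans)
  then show ?thesis
    by (simp add: affine_hull_coset_tetrahedron[OF assms] had_flat_subset_iff)
qed

text \<open>Among the nine indices the hyperplane lacks only \<open>(r, c)\<close>, so containment
  fails exactly when this pair is on the graph. All incidence counts rest on this criterion.\<close>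

lemma coset_tetrahedron_subset_Pi_hyp:
  assumes \<pi>: "\<pi> permutes {1,2,3}" and r: "r \<in> {1,2,3}" and c: "c \<in> {1,2,3}"
  shows "coset_tetrahedron (klein_coset \<pi>) \<subseteq> Pi_hyp r c \<longleftrightarrow> \<pi> r \<noteq> c"
proof -
  have "graph_123 \<pi> \<subseteq> {1,2,3} \<times> {1,2,3}"
    using permutes_in_image[OF \<pi>] unfolding graph_123_def by blast
  then show ?thesis
    using r by (auto simp: Pi_hyp_eq[OF r c] coset_tetrahedron_subset_had_flat[OF \<pi>] graph_123_def)
qed

text \<open>The affine hull determines the graph, and the graph determines the permutation.\<close>

lemma inj_on_coset_tetrahedron: "inj_on (\<lambda>\<pi>. coset_tetrahedron (klein_coset \<pi>)) {\<pi>. \<pi> permutes {1,2,3}}"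
proof (rule inj_onI, clarify)
  fix \<pi> \<rho> :: "4 \<Rightarrow> 4"
  assume perm: "\<pi> permutes {1,2,3}" "\<rho> permutes {1,2,3}"
    and "coset_tetrahedron (klein_coset \<pi>) = coset_tetrahedron (klein_coset \<rho>)"
  then have "graph_123 \<pi> = graph_123 \<rho>"
    by (metis affine_hull_coset_tetrahedron had_flat_eq_iff)
  then have "\<pi> a = \<rho> a" if "a \<in> {1,2,3}" for a
  proof -
    have "(a, \<pi> a) \<in> graph_123 \<rho>"
      using that \<open>graph_123 \<pi> = graph_123 \<rho>\<close> unfolding graph_123_def by blast
    then show ?thesis
      by (auto simp: graph_123_def)
  qed
  then show "\<pi> = \<rho>"
    using perm by (metis ext permutes_not_in)
qed

lemma inner_perm_matrix:
  "perm_matrix \<sigma> \<bullet> perm_matrix \<tau> = real (card {i. \<sigma> i = \<tau> i})"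
proof -
  have "perm_matrix \<sigma> \<bullet> perm_matrix \<tau> = (\<Sum>i\<in>UNIV. if \<sigma> i = \<tau> i then 1 else 0)"
    by (simp add: inner_vec_def perm_matrix_def mult_delta_left)
  also have "\<dots> = real (card {i. \<sigma> i = \<tau> i})"
    by (simp flip: sum.inter_filter)
  finally show ?thesis .
qed

lemma regular_tetrahedron_coset:
  assumes \<pi>: "\<pi> permutes {1,2,3}"
  shows "regular_tetrahedron (coset_tetrahedron (klein_coset \<pi>)) B_star"
proof -
  define P where "P k = perm_matrix (\<pi> \<circ> klein k)" for k
  have range_P: "perm_matrix ` klein_coset \<pi> = range P"
    by (simp add: klein_coset_def P_def image_image)
  \<comment> \<open>Distinct translates agree nowhere, so the four vertices are orthogonal with
    squared norm 4; their mutual distance is therefore \<open>sqrt 8\<close>.\<close>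
  have inner: "P k \<bullet> P l = (if k = l then 4 else 0)" for k l
    by (simp add: P_def inner_perm_matrix inj_eq[OF permutes_inj[OF \<pi>]])
  have inj: "inj P"
    unfolding P_def by (rule inj_perm_matrix_klein[OF \<pi>])
  then have card: "card (range P) = 4"
    by (simp add: card_image)
  have "aff_dim (range P) = 3"
  proof -
    have "aff_dim (range P) = aff_dim (had_flat (graph_123 \<pi>))"
      by (metis affine_hull_coset_tetrahedron[OF \<pi>] affine_hull_convex_hull aff_dim_affine_hull
          coset_tetrahedron_def range_P)
    then show ?thesis
      by (simp add: aff_dim_had_flat card_graph_123)
  qed
  then have "\<not> affine_dependent (range P)"
    by (simp add: affine_independent_iff_card card)
  moreover have "dist x y = sqrt 8" if "x \<in> range P" "y \<in> range P" "x \<noteq> y" for x y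
    using that by (auto simp: dist_norm norm_eq_sqrt_inner inner_diff_left inner_diff_right inner)
  \<comment> \<open>Summing over \<open>k\<close> kills all nontrivial characters. Only coordinate
    (0, 0) is left, with value 16, and a quarter of it is that of \<open>B_star\<close>.\<close>
  moreover have "B_star = (1/4) *\<^sub>R (\<Sum>x\<in>range P. x)"
  proof (rule had_mat_eqI)
    fix a b
    have "\<pi> 0 = 0"
      using \<pi> permutes_123_iff by blast
    moreover have "(\<Sum>k\<in>UNIV. had a k) = (if a = 0 then 4 else 0)"
      using had_orthogonal[of a 0] by simp
    moreover have "(\<Sum>x\<in>range P. x) = sum P UNIV"
      by (simp add: sum.reindex[OF inj])
    moreover have "had_mat a b \<bullet> sum P UNIV = (if b = \<pi> a then 4 * (\<Sum>k\<in>UNIV. had a k) else 0)"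
      by (simp add: inner_sum_right P_def inner_had_mat_klein_coset[OF \<pi>] sum_distrib_left)
    ultimately show "had_mat a b \<bullet> B_star = had_mat a b \<bullet> ((1/4) *\<^sub>R (\<Sum>x\<in>range P. x))"
      by (auto simp: inner_had_mat_B_star)
  qed
  ultimately show ?thesis
    unfolding regular_tetrahedron_def coset_tetrahedron_def range_P using card by blast
qed

section \<open>Counting incidences\<close>

lemma permutes_123_with_value:
  fixes r c :: 4
  assumes r: "r \<in> {1,2,3}" and c: "c \<in> {1,2,3}"
  obtains \<pi> \<rho> where "{\<sigma>. \<sigma> permutes {1,2,3} \<and> \<sigma> r = c} = {\<pi>, \<rho>}" "\<pi> \<noteq> \<rho>"
    "graph_123 \<pi> \<inter> graph_123 \<rho> = {(r, c)}"
proof -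
  have split: "\<exists>s t. {1,2,3} = {q, s, t} \<and> distinct [q, s, t]" if q: "q \<in> {1,2,3}" for q :: 4
  proof -
    consider "q = 1" | "q = 2" | "q = 3"
      using q by blast
    then show ?thesis
    proof cases
      case 1
      then show ?thesis by (intro exI[of _ 2] exI[of _ 3]) auto
    next
      case 2
      then show ?thesis by (intro exI[of _ 1] exI[of _ 3]) auto
    next
      case 3
      then show ?thesis by (intro exI[of _ 1] exI[of _ 2]) auto
    qed
  qed
  obtain s t where st: "{1,2,3} = {r, s, t}" "distinct [r, s, t]"
    using split[OF r] by blast
  obtain d e where de: "{1,2,3} = {c, d, e}" "distinct [c, d, e]"
    using split[OF c] by blast
  \<comment> \<open>The last branch is reached only at 0. The two candidates \<open>f d e\<close>
    and \<open>f e d\<close> swap the values at \<open>s\<close> and \<open>t\<close>, so their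
    graphs meet only over \<open>r\<close>.\<close>
  define f :: "4 \<Rightarrow> 4 \<Rightarrow> 4 \<Rightarrow> 4" where
    "f x y = (\<lambda>i. if i = r then c else if i = s then x else if i = t then y else i)" for x y
  have perm: "f x y permutes {1,2,3}" if "{c, d, e} = {c, x, y}" "distinct [c, x, y]" for x y
  proof (rule bij_imp_permutes)
    have "f x y ` {r, s, t} = {c, x, y}"
      using st(2) by (auto simp: f_def)
    then have img: "f x y ` {1,2,3} = {1,2,3}"
      by (metis st(1) de(1) that(1))
    moreover from img have "inj_on (f x y) {1,2,3}"
      by (intro eq_card_imp_inj_on) auto
    ultimately show "bij_betw (f x y) {1,2,3} {1,2,3}"
      by (simp only: bij_betw_def)
    show "f x y i = i" if "i \<notin> {1,2,3}" for i
      using that unfolding st(1) by (auto simp: f_def)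
  qed
  have "{\<sigma>. \<sigma> permutes {1,2,3} \<and> \<sigma> r = c} = {f d e, f e d}"
  proof (intro equalityI subsetI)
    fix \<sigma> assume "\<sigma> \<in> {f d e, f e d}"
    then show "\<sigma> \<in> {\<sigma>. \<sigma> permutes {1,2,3} \<and> \<sigma> r = c}"
      using perm[of d e] perm[of e d] de(2) by (auto simp: f_def)
  next
    fix \<sigma> assume "\<sigma> \<in> {\<sigma>. \<sigma> permutes {1,2,3} \<and> \<sigma> r = c}"
    then have \<sigma>: "\<sigma> permutes {1,2,3}" "\<sigma> r = c"
      by auto
    have "\<sigma> s \<in> {c, d, e}" "\<sigma> t \<in> {c, d, e}"
      unfolding de(1)[symmetric] permutes_in_image[OF \<sigma>(1)] unfolding st(1) by auto
    moreover have "\<sigma> s \<noteq> c" "\<sigma> t \<noteq> c" "\<sigma> s \<noteq> \<sigma> t"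
      using st(2) \<sigma>(2) inj_eq[OF permutes_inj[OF \<sigma>(1)]] by auto
    moreover have "\<sigma> = f (\<sigma> s) (\<sigma> t)"
      using \<sigma>(2) permutes_not_in[OF \<sigma>(1)] unfolding st(1) by (intro ext) (auto simp: f_def)
    ultimately show "\<sigma> \<in> {f d e, f e d}"
      by auto
  qed
  moreover have "f d e s \<noteq> f e d s"
    using st(2) de(2) by (auto simp: f_def)
  then have "f d e \<noteq> f e d"
    by metis
  moreover have "graph_123 (f d e) \<inter> graph_123 (f e d) = {(r, c)}"
    unfolding graph_123_def st(1) using st(2) de(2) by (auto simp: f_def)
  ultimately show ?thesis
    using that by blast
qed

lemma inj_on_klein_coset: "inj_on klein_coset {\<pi>. \<pi> permutes {1,2,3}}"
  using inj_on_coset_tetrahedron unfolding inj_on_def by metis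

lemma card_klein_cosets: "card klein_cosets = 6"
proof -
  have "card {\<pi>. \<pi> permutes {1,2,3::4}} = fact 3"
    by (rule card_permutations) auto
  then show ?thesis
    by (simp add: klein_cosets_eq card_image inj_on_klein_coset fact_numeral)
qed

lemma card_perm_matrices: "card {perm_matrix \<sigma> | \<sigma>. \<sigma> permutes UNIV} = 24"
proof -
  have "card {\<sigma>. \<sigma> permutes (UNIV :: 4 set)} = fact 4"
    by (rule card_permutations) auto
  then show ?thesis
    by (simp add: setcompr_eq_image card_image inj_on_subset[OF inj_perm_matrix] fact_numeral)
qed

text \<open>Row 1 suffices: any nonzero column other than \<open>\<pi> 1\<close> gives a hyperplane
  containing the whole tetrahedron of the coset.\<close>

lemma perm_matrix_in_some_Pi_hyp:
  assumes "\<sigma> permutes UNIV"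
  shows "\<exists>r\<in>{1,2,3}. \<exists>c\<in>{1,2,3}. perm_matrix \<sigma> \<in> Pi_hyp r c"
proof -
  obtain \<pi> k where \<pi>: "\<pi> permutes {1,2,3}" and \<sigma>: "\<sigma> = \<pi> \<circ> klein k"
    using permutes_UNIV_klein[OF assms] .
  have "perm_matrix \<sigma> \<in> coset_tetrahedron (klein_coset \<pi>)"
    unfolding coset_tetrahedron_def klein_coset_def \<sigma> by (intro hull_inc) blast
  moreover obtain c :: 4 where c: "c \<in> {1,2,3}" "\<pi> 1 \<noteq> c"
  proof (cases "\<pi> 1 = 1")
    case True
    then show ?thesis using that[of 2] by simp
  qed (use that[of 1] in simp)
  moreover have "coset_tetrahedron (klein_coset \<pi>) \<subseteq> Pi_hyp 1 c"
    using coset_tetrahedron_subset_Pi_hyp[OF \<pi> _ c(1), of 1] c(2) by simp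
  ultimately show ?thesis
    by blast
qed

text \<open>The complement of a three-point graph in the grid of nine pairs.\<close>

lemma card_hyperplanes_containing:
  assumes \<pi>: "\<pi> permutes {1,2,3}"
  shows "card {(r, c) \<in> {1,2,3} \<times> {1,2,3}. coset_tetrahedron (klein_coset \<pi>) \<subseteq> Pi_hyp r c} = 6"
proof -
  have "{(r, c) \<in> {1,2,3} \<times> {1,2,3}. coset_tetrahedron (klein_coset \<pi>) \<subseteq> Pi_hyp r c}
      = {(r, c) \<in> {1,2,3} \<times> {1,2,3}. \<pi> r \<noteq> c}"
    using coset_tetrahedron_subset_Pi_hyp[OF \<pi>] by blast
  also have "\<dots> = {1,2,3} \<times> {1,2,3} - graph_123 \<pi>"
    unfolding graph_123_def by blast
  also have "card \<dots> = card ({1,2,3::4} \<times> {1,2,3::4}) - card (graph_123 \<pi>)"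
    using permutes_in_image[OF \<pi>] unfolding graph_123_def by (intro card_Diff_subset) blast+
  finally show ?thesis
    by (simp add: card_graph_123)
qed

text \<open>The cosets missed correspond to the two permutations of {1, 2, 3} taking
  \<open>r\<close> to \<open>c\<close>; their affine hulls intersect in the flat over the common
  graph point.\<close>

lemma cosets_not_in_Pi_hyp:
  assumes r: "r \<in> {1,2,3}" and c: "c \<in> {1,2,3}"
  obtains C D where "C \<noteq> D" "C \<in> klein_cosets" "D \<in> klein_cosets"
    "{E \<in> klein_cosets. \<not> coset_tetrahedron E \<subseteq> Pi_hyp r c} = {C, D}"
    "affine hull (coset_tetrahedron C) \<inter> affine hull (coset_tetrahedron D) = had_flat {(r, c)}"
proof -
  obtain \<pi> \<rho> where eq: "{\<sigma>. \<sigma> permutes {1,2,3} \<and> \<sigma> r = c} = {\<pi>, \<rho>}" and "\<pi> \<noteq> \<rho>"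
    and Int: "graph_123 \<pi> \<inter> graph_123 \<rho> = {(r, c)}"
    using permutes_123_with_value[OF r c] .
  have perm: "\<pi> permutes {1,2,3}" "\<rho> permutes {1,2,3}"
    using eq by blast+
  have "klein_coset \<pi> \<noteq> klein_coset \<rho>"
    using inj_onD[OF inj_on_klein_coset, of \<pi> \<rho>] perm \<open>\<pi> \<noteq> \<rho>\<close> by blast
  moreover have "{E \<in> klein_cosets. \<not> coset_tetrahedron E \<subseteq> Pi_hyp r c}
      = klein_coset ` {\<sigma>. \<sigma> permutes {1,2,3} \<and> \<sigma> r = c}"
    unfolding klein_cosets_eq using coset_tetrahedron_subset_Pi_hyp[OF _ r c] by blast
  then have "{E \<in> klein_cosets. \<not> coset_tetrahedron E \<subseteq> Pi_hyp r c} = {klein_coset \<pi>, klein_coset \<rho>}"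
    by (simp only: eq image_insert image_empty)
  moreover have "affine hull (coset_tetrahedron (klein_coset \<pi>))
      \<inter> affine hull (coset_tetrahedron (klein_coset \<rho>)) = had_flat {(r, c)}"
    by (simp only: affine_hull_coset_tetrahedron perm had_flat_Int Int)
  moreover have "klein_coset \<pi> \<in> klein_cosets" "klein_coset \<rho> \<in> klein_cosets"
    unfolding klein_cosets_eq using perm by blast+
  ultimately show ?thesis
    using that by blast
qed

lemma card_cosets_in_Pi_hyp:
  assumes "r \<in> {1,2,3}" "c \<in> {1,2,3}"
  shows "card {C \<in> klein_cosets. coset_tetrahedron C \<subseteq> Pi_hyp r c} = 4"
proof -
  obtain C D where CD: "C \<noteq> D" "C \<in> klein_cosets" "D \<in> klein_cosets"
    "{E \<in> klein_cosets. \<not> coset_tetrahedron E \<subseteq> Pi_hyp r c} = {C, D}"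
    using cosets_not_in_Pi_hyp[OF assms] .
  then have "{C \<in> klein_cosets. coset_tetrahedron C \<subseteq> Pi_hyp r c} = klein_cosets - {C, D}"
    by blast
  also have "card \<dots> = card klein_cosets - card {C, D}"
    using CD(2,3) by (intro card_Diff_subset) auto
  finally show ?thesis
    using CD(1) by (simp add: card_klein_cosets)
qed

text \<open>A normal is known only up to a nonzero factor \<open>s\<close>, which the line parameter
  absorbs.\<close>

lemma range_normal_line:
  assumes "s \<noteq> 0"
  shows "range (\<lambda>t. B_star + t *\<^sub>R s *\<^sub>R had_mat r c) = had_flat {(r, c)}"
proof -
  have "range (\<lambda>t. t *\<^sub>R s *\<^sub>R had_mat r c) = range (\<lambda>t. t *\<^sub>R had_mat r c)"
  proof (intro equalityI subsetI; elim rangeE)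
    fix x t assume "x = t *\<^sub>R had_mat r c"
    then have "x = (t / s) *\<^sub>R s *\<^sub>R had_mat r c"
      using assms by simp
    then show "x \<in> range (\<lambda>t. t *\<^sub>R s *\<^sub>R had_mat r c)"
      by (rule range_eqI)
  qed auto
  then have "had_space {(r, c)} = range (\<lambda>t. t *\<^sub>R s *\<^sub>R had_mat r c)"
    by (simp add: had_space_eq_span span_singleton)
  then show ?thesis
    by (simp only: had_flat_def image_image)
qed

text \<open>The first block of conjuncts sets the scene. Its injectivity claims ensure that counting
  index pairs and cosets really counts hyperplanes and tetrahedra.\<close>

theorem theorem2:
  fixes n :: "4 \<Rightarrow> 4 \<Rightarrow> real^4^4"
  assumes normal: "\<And>r c. r \<in> {1,2,3} \<Longrightarrow> c \<in> {1,2,3} \<Longrightarrow> is_normal (Pi_hyp r c) (n r c)"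
  shows
    "(affine unit_sums \<and> aff_dim unit_sums = 9 \<and> direction_space unit_sums = zero_sums
      \<and> (\<forall>r\<in>{1,2,3}. \<forall>c\<in>{1,2,3}.
            affine (Pi_hyp r c) \<and> aff_dim (Pi_hyp r c) = 8 \<and> B_star \<in> Pi_hyp r c)
      \<and> inj_on (\<lambda>(r, c). Pi_hyp r c) ({1,2,3} \<times> {1,2,3})
      \<and> card {perm_matrix \<sigma> | \<sigma>. \<sigma> permutes UNIV} = 24
      \<and> card klein_cosets = 6 \<and> inj_on coset_tetrahedron klein_cosets
      \<and> (\<forall>C\<in>klein_cosets. regular_tetrahedron (coset_tetrahedron C) B_star))
   \<and> ((\<forall>r\<in>{1,2,3}. \<forall>c\<in>{1,2,3}. \<forall>r'\<in>{1,2,3}. \<forall>c'\<in>{1,2,3}.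
            (r, c) \<noteq> (r', c') \<longrightarrow> orthogonal (n r c) (n r' c'))
      \<and> (\<forall>\<sigma>. \<sigma> permutes UNIV \<longrightarrow> (\<exists>r\<in>{1,2,3}. \<exists>c\<in>{1,2,3}. perm_matrix \<sigma> \<in> Pi_hyp r c)))
   \<and> (\<forall>C\<in>klein_cosets.
          card {(r, c) \<in> {1,2,3} \<times> {1,2,3}. coset_tetrahedron C \<subseteq> Pi_hyp r c} = 6
        \<and> (\<forall>r\<in>{1,2,3}. \<forall>c\<in>{1,2,3}. \<not> coset_tetrahedron C \<subseteq> Pi_hyp r c \<longrightarrow>
              n r c \<in> direction_space (affine hull (coset_tetrahedron C))))
   \<and> (\<forall>r\<in>{1,2,3}. \<forall>c\<in>{1,2,3}.
          card {C \<in> klein_cosets. coset_tetrahedron C \<subseteq> Pi_hyp r c} = 4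
        \<and> (\<exists>C\<^sub>1 C\<^sub>2. C\<^sub>1 \<noteq> C\<^sub>2
            \<and> {C \<in> klein_cosets. \<not> coset_tetrahedron C \<subseteq> Pi_hyp r c} = {C\<^sub>1, C\<^sub>2}
            \<and> range (\<lambda>t. B_star + t *\<^sub>R n r c)
              = affine hull (coset_tetrahedron C\<^sub>1) \<inter> affine hull (coset_tetrahedron C\<^sub>2)))"
proof (intro conjI)
  \<comment> \<open>Reduces claims about arbitrary normals to the basis matrices.\<close>
  have scaled: "\<exists>s. s \<noteq> 0 \<and> n r c = s *\<^sub>R had_mat r c" if "r \<in> {1,2,3}" "c \<in> {1,2,3}" for r c
    using is_normal_Pi_hyp[OF that normal[OF that]] by blast
  show "affine unit_sums" "aff_dim unit_sums = 9" "direction_space unit_sums = zero_sums"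
    by (simp_all add: unit_sums_eq zero_sums_eq affine_had_flat aff_dim_had_flat direction_space_had_flat)
  show "\<forall>r\<in>{1,2,3}. \<forall>c\<in>{1,2,3}.
      affine (Pi_hyp r c) \<and> aff_dim (Pi_hyp r c) = 8 \<and> B_star \<in> Pi_hyp r c"
  proof (intro ballI)
    fix r c :: 4 assume rc: "r \<in> {1,2,3}" "c \<in> {1,2,3}"
    then have "card ({1,2,3} \<times> {1,2,3} - {(r, c)}) = 8"
      by (subst card_Diff_singleton) auto
    then show "affine (Pi_hyp r c) \<and> aff_dim (Pi_hyp r c) = 8 \<and> B_star \<in> Pi_hyp r c"
      by (simp only: Pi_hyp_eq[OF rc] affine_had_flat aff_dim_had_flat B_star_in_had_flat) simp
  qed
  show "inj_on (\<lambda>(r, c). Pi_hyp r c) ({1,2,3} \<times> {1,2,3})"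
  proof (rule inj_onI, clarify)
    fix r c r' c' :: 4
    assume "r \<in> {1,2,3}" "c \<in> {1,2,3}" "r' \<in> {1,2,3}" "c' \<in> {1,2,3}" "Pi_hyp r c = Pi_hyp r' c'"
    then have "{1,2,3} \<times> {1,2,3} - {(r, c)} = {1,2,3} \<times> {1,2,3} - {(r', c')}"
      "(r, c) \<in> {1,2,3} \<times> {1,2,3}"
      by (simp_all only: Pi_hyp_eq had_flat_eq_iff mem_Sigma_iff)
    then show "r = r' \<and> c = c'"
      by blast
  qed
  show "card {perm_matrix \<sigma> | \<sigma>. \<sigma> permutes UNIV} = 24"
    by (rule card_perm_matrices)
  show "card klein_cosets = 6"
    by (rule card_klein_cosets)
  show "inj_on coset_tetrahedron klein_cosets"
    unfolding klein_cosets_eq using inj_on_coset_tetrahedron by (intro inj_on_imageI) (simp add: comp_def)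
  show "\<forall>C\<in>klein_cosets. regular_tetrahedron (coset_tetrahedron C) B_star"
    unfolding klein_cosets_eq using regular_tetrahedron_coset by blast
  show "\<forall>r\<in>{1,2,3}. \<forall>c\<in>{1,2,3}. \<forall>r'\<in>{1,2,3}. \<forall>c'\<in>{1,2,3}.
      (r, c) \<noteq> (r', c') \<longrightarrow> orthogonal (n r c) (n r' c')"
  proof (intro ballI impI)
    fix r c r' c' :: 4
    assume "r \<in> {1,2,3}" "c \<in> {1,2,3}" "r' \<in> {1,2,3}" "c' \<in> {1,2,3}" and neq: "(r, c) \<noteq> (r', c')"
    then obtain s s' where "n r c = s *\<^sub>R had_mat r c" "n r' c' = s' *\<^sub>R had_mat r' c'"
      using scaled by metis
    then show "orthogonal (n r c) (n r' c')"
      using neq by (auto simp: orthogonal_def had_mat_orthogonal)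
  qed
  show "\<forall>\<sigma>. \<sigma> permutes UNIV \<longrightarrow> (\<exists>r\<in>{1,2,3}. \<exists>c\<in>{1,2,3}. perm_matrix \<sigma> \<in> Pi_hyp r c)"
    using perm_matrix_in_some_Pi_hyp by blast
  show "\<forall>C\<in>klein_cosets.
      card {(r, c) \<in> {1,2,3} \<times> {1,2,3}. coset_tetrahedron C \<subseteq> Pi_hyp r c} = 6
    \<and> (\<forall>r\<in>{1,2,3}. \<forall>c\<in>{1,2,3}. \<not> coset_tetrahedron C \<subseteq> Pi_hyp r c \<longrightarrow>
          n r c \<in> direction_space (affine hull (coset_tetrahedron C)))"
  proof (intro ballI conjI impI)
    fix C assume "C \<in> klein_cosets"
    then obtain \<pi> where \<pi>: "\<pi> permutes {1,2,3}" and C: "C = klein_coset \<pi>"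
      unfolding klein_cosets_eq by blast
    show "card {(r, c) \<in> {1,2,3} \<times> {1,2,3}. coset_tetrahedron C \<subseteq> Pi_hyp r c} = 6"
      unfolding C by (rule card_hyperplanes_containing[OF \<pi>])
    fix r c :: 4
    assume rc: "r \<in> {1,2,3}" "c \<in> {1,2,3}" and "\<not> coset_tetrahedron C \<subseteq> Pi_hyp r c"
    \<comment> \<open>Not being contained means \<open>\<pi> r = c\<close>, so
      \<open>had_mat r c\<close> is one of the three basis directions of the tetrahedron.\<close>
    then have "(r, c) \<in> graph_123 \<pi>"
      unfolding C coset_tetrahedron_subset_Pi_hyp[OF \<pi> rc] graph_123_def by blast
    moreover obtain s where "n r c = s *\<^sub>R had_mat r c"
      using scaled[OF rc] by blast
    ultimately show "n r c \<in> direction_space (affine hull (coset_tetrahedron C))"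
      unfolding C affine_hull_coset_tetrahedron[OF \<pi>] direction_space_had_flat
      by (simp add: subspace_scale[OF subspace_had_space])
  qed
  show "\<forall>r\<in>{1,2,3}. \<forall>c\<in>{1,2,3}.
      card {C \<in> klein_cosets. coset_tetrahedron C \<subseteq> Pi_hyp r c} = 4
    \<and> (\<exists>C\<^sub>1 C\<^sub>2. C\<^sub>1 \<noteq> C\<^sub>2
        \<and> {C \<in> klein_cosets. \<not> coset_tetrahedron C \<subseteq> Pi_hyp r c} = {C\<^sub>1, C\<^sub>2}
        \<and> range (\<lambda>t. B_star + t *\<^sub>R n r c)
          = affine hull (coset_tetrahedron C\<^sub>1) \<inter> affine hull (coset_tetrahedron C\<^sub>2))"
  proof (intro ballI conjI)
    fix r c :: 4 assume rc: "r \<in> {1,2,3}" "c \<in> {1,2,3}"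
    show "card {C \<in> klein_cosets. coset_tetrahedron C \<subseteq> Pi_hyp r c} = 4"
      by (rule card_cosets_in_Pi_hyp[OF rc])
    obtain s where "s \<noteq> 0" "n r c = s *\<^sub>R had_mat r c"
      using scaled[OF rc] by blast
    then have line: "range (\<lambda>t. B_star + t *\<^sub>R n r c) = had_flat {(r, c)}"
      by (simp add: range_normal_line del: scaleR_scaleR)
    obtain C D where CD: "C \<noteq> D"
      "{E \<in> klein_cosets. \<not> coset_tetrahedron E \<subseteq> Pi_hyp r c} = {C, D}"
      "affine hull (coset_tetrahedron C) \<inter> affine hull (coset_tetrahedron D) = had_flat {(r, c)}"
      using cosets_not_in_Pi_hyp[OF rc] .
    show "\<exists>C\<^sub>1 C\<^sub>2. C\<^sub>1 \<noteq> C\<^sub>2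
        \<and> {C \<in> klein_cosets. \<not> coset_tetrahedron C \<subseteq> Pi_hyp r c} = {C\<^sub>1, C\<^sub>2}
        \<and> range (\<lambda>t. B_star + t *\<^sub>R n r c)
          = affine hull (coset_tetrahedron C\<^sub>1) \<inter> affine hull (coset_tetrahedron C\<^sub>2)"
      unfolding line CD(3)[symmetric] by (rule exI[of _ C], rule exI[of _ D], intro conjI CD(1,2) refl)
  qed
qed

end
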